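(* Let $r\in\mathbb{C}$ be nonzero and not of the form $-1/m$ with $m$ a positive integer, and let $b_0,b_1,b_2,s_1,s_2\in\mathbb{C}$. Then, as rational functions of $n$, $$\alpha(n,r)=\frac{1}{256\,r^6}\bigl(d_0y_0+d_1y_1+d_2y_2+d_3y_3+d_4y_4\bigr),$$ where $$y_0=(4r^2n)^2(nr-2r+1)^2,\qquad y_1=4r^3n(nr-2r+1),\qquad y_2=1,$$ $$y_3=\frac{(r-1)(3r-1)}{(2nr-r+1)(2nr-3r+1)},\qquad y_4=\frac{-(2r-1)^2}{(2nr-2r+1)^2},$$ and $d_0=b_2^2$, $d_1=p_1$, $d_3=p_2p_3$, $d_4=p_4^2$, $d_2=d_4-d_3$ with $$p_1=\bigl(b_2^2+8b_2(b_0+b_1)-4b_1^2\bigr)r^2+4b_2(2s_2+b_1-2b_2)r-2b_2^2,$$ $$p_2=(4b_0+2b_1-b_2)r^3+(8s_1+4s_2+4b_0-b_2)r^2+(b_2-4s_2-2b_1)r+b_2,$$ $$p_3=(2b_1-4b_0-3b_2)r^3+(8s_1-4s_2+4b_0-b_2)r^2+(3b_2-4s_2-2b_1)r+b_2,$$ $$p_4=(8s_1+4b_0)r^2+(2b_2-4s_2-2b_1)r+b_2.$$ Moreover, if $r\notin\{0,1,\tfrac12,\tfrac13\}$, then the functions $y_0,y_1,y_2,y_3,y_4$ of $n$ are linearly independent.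
   Context: Put $x_k=b_0+b_1k+b_2k(k-1)$ and $$\gamma(n,m,r)=\frac{(n-m+1)\bigl((nr-mr+1)x_{n-m}+(n-m)s_2+s_1\bigr)}{(2n-m-1)r+1},$$ $$\alpha(n,r)=\gamma(n,1,r)\Bigl(\tfrac12\bigl(\gamma(n,0,r)-2\gamma(n,1,r)+\gamma(n,2,r)\bigr)-(x_n-x_{n-1})\Bigr),$$ regarded as rational functions of $n$. *)

theory Defs
  imports Complex_Main "HOL-Computational_Algebra.Computational_Algebra"
begin

type_synonym ratfun = "complex poly fract"

definition Const :: "complex \<Rightarrow> ratfun" where
  "Const c = to_fract [:c:]"

definition Var :: ratfun where
  "Var = to_fract [:0, 1:]"

definition scale_ratfun :: "complex \<Rightarrow> ratfun \<Rightarrow> ratfun" where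
  "scale_ratfun c f = Const c * f"

global_interpretation ratfun: vector_space scale_ratfun
proof
  have add: "Const (a + b) = Const a + Const b" for a b
    by (simp add: Const_def flip: to_fract_add)
  have mult: "Const (a * b) = Const a * Const b" for a b
    by (simp add: Const_def flip: to_fract_mult)
  have one: "Const 1 = 1"
    by (simp add: Const_def flip: one_pCons)
  fix a b :: complex and f g :: ratfun
  show "scale_ratfun a (f + g) = scale_ratfun a f + scale_ratfun a g"
    by (simp add: scale_ratfun_def algebra_simps)
  show "scale_ratfun (a + b) f = scale_ratfun a f + scale_ratfun b f"
    by (simp add: scale_ratfun_def add algebra_simps)
  show "scale_ratfun a (scale_ratfun b f) = scale_ratfun (a * b) f"
    by (simp add: scale_ratfun_def mult algebra_simps)
  show "scale_ratfun 1 f = f"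
    by (simp add: scale_ratfun_def one)
qed

definition xk :: "complex \<Rightarrow> complex \<Rightarrow> complex \<Rightarrow> ratfun \<Rightarrow> ratfun" where
  "xk b0 b1 b2 k = Const b0 + Const b1 * k + Const b2 * k * (k - 1)"

definition gamma_rf ::
  "complex \<Rightarrow> complex \<Rightarrow> complex \<Rightarrow> complex \<Rightarrow> complex \<Rightarrow> ratfun \<Rightarrow> ratfun \<Rightarrow> complex \<Rightarrow> ratfun" where
  "gamma_rf b0 b1 b2 s1 s2 n m r =
     (n - m + 1) *
     ((n * Const r - m * Const r + 1) * xk b0 b1 b2 (n - m) + (n - m) * Const s2 + Const s1)
     / ((2 * n - m - 1) * Const r + 1)"

definition alpha_rf ::
  "complex \<Rightarrow> complex \<Rightarrow> complex \<Rightarrow> complex \<Rightarrow> complex \<Rightarrow> ratfun \<Rightarrow> complex \<Rightarrow> ratfun" where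
  "alpha_rf b0 b1 b2 s1 s2 n r =
     gamma_rf b0 b1 b2 s1 s2 n 1 r *
     (1 / 2 * (gamma_rf b0 b1 b2 s1 s2 n 0 r - 2 * gamma_rf b0 b1 b2 s1 s2 n 1 r
               + gamma_rf b0 b1 b2 s1 s2 n 2 r)
      - (xk b0 b1 b2 n - xk b0 b1 b2 (n - 1)))"

definition y0 :: "ratfun \<Rightarrow> complex \<Rightarrow> ratfun" where
  "y0 n r = (4 * Const r ^ 2 * n) ^ 2 * (n * Const r - 2 * Const r + 1) ^ 2"

definition y1 :: "ratfun \<Rightarrow> complex \<Rightarrow> ratfun" where
  "y1 n r = 4 * Const r ^ 3 * n * (n * Const r - 2 * Const r + 1)"

definition y2 :: "ratfun \<Rightarrow> complex \<Rightarrow> ratfun" where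
  "y2 n r = 1"

definition y3 :: "ratfun \<Rightarrow> complex \<Rightarrow> ratfun" where
  "y3 n r = (Const r - 1) * (3 * Const r - 1)
     / ((2 * n * Const r - Const r + 1) * (2 * n * Const r - 3 * Const r + 1))"

definition y4 :: "ratfun \<Rightarrow> complex \<Rightarrow> ratfun" where
  "y4 n r = - ((2 * Const r - 1) ^ 2) / (2 * n * Const r - 2 * Const r + 1) ^ 2"

definition p1 :: "complex \<Rightarrow> complex \<Rightarrow> complex \<Rightarrow> complex \<Rightarrow> complex \<Rightarrow> complex \<Rightarrow> complex" where
  "p1 b0 b1 b2 s1 s2 r =
     (b2 ^ 2 + 8 * b2 * (b0 + b1) - 4 * b1 ^ 2) * r ^ 2
     + 4 * b2 * (2 * s2 + b1 - 2 * b2) * r - 2 * b2 ^ 2"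

definition p2 :: "complex \<Rightarrow> complex \<Rightarrow> complex \<Rightarrow> complex \<Rightarrow> complex \<Rightarrow> complex \<Rightarrow> complex" where
  "p2 b0 b1 b2 s1 s2 r =
     (4 * b0 + 2 * b1 - b2) * r ^ 3 + (8 * s1 + 4 * s2 + 4 * b0 - b2) * r ^ 2
     + (b2 - 4 * s2 - 2 * b1) * r + b2"

definition p3 :: "complex \<Rightarrow> complex \<Rightarrow> complex \<Rightarrow> complex \<Rightarrow> complex \<Rightarrow> complex \<Rightarrow> complex" where
  "p3 b0 b1 b2 s1 s2 r =
     (2 * b1 - 4 * b0 - 3 * b2) * r ^ 3 + (8 * s1 - 4 * s2 + 4 * b0 - b2) * r ^ 2
     + (3 * b2 - 4 * s2 - 2 * b1) * r + b2"

definition p4 :: "complex \<Rightarrow> complex \<Rightarrow> complex \<Rightarrow> complex \<Rightarrow> complex \<Rightarrow> complex \<Rightarrow> complex" where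
  "p4 b0 b1 b2 s1 s2 r =
     (8 * s1 + 4 * b0) * r ^ 2 + (2 * b2 - 4 * s2 - 2 * b1) * r + b2"

definition d0 :: "complex \<Rightarrow> complex \<Rightarrow> complex \<Rightarrow> complex \<Rightarrow> complex \<Rightarrow> complex \<Rightarrow> complex" where
  "d0 b0 b1 b2 s1 s2 r = b2 ^ 2"

definition d1 :: "complex \<Rightarrow> complex \<Rightarrow> complex \<Rightarrow> complex \<Rightarrow> complex \<Rightarrow> complex \<Rightarrow> complex" where
  "d1 b0 b1 b2 s1 s2 r = p1 b0 b1 b2 s1 s2 r"

definition d3 :: "complex \<Rightarrow> complex \<Rightarrow> complex \<Rightarrow> complex \<Rightarrow> complex \<Rightarrow> complex \<Rightarrow> complex" where
  "d3 b0 b1 b2 s1 s2 r = p2 b0 b1 b2 s1 s2 r * p3 b0 b1 b2 s1 s2 r"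

definition d4 :: "complex \<Rightarrow> complex \<Rightarrow> complex \<Rightarrow> complex \<Rightarrow> complex \<Rightarrow> complex \<Rightarrow> complex" where
  "d4 b0 b1 b2 s1 s2 r = p4 b0 b1 b2 s1 s2 r ^ 2"

definition d2 :: "complex \<Rightarrow> complex \<Rightarrow> complex \<Rightarrow> complex \<Rightarrow> complex \<Rightarrow> complex \<Rightarrow> complex" where
  "d2 b0 b1 b2 s1 s2 r = d4 b0 b1 b2 s1 s2 r - d3 b0 b1 b2 s1 s2 r"

end

theory Submission
  imports Defs
begin

text \<open>The poles of \<alpha> can only come from the denominators
  \<open>D m = (2 * n - m - 1) * r + 1\<close> of \<gamma> for \<open>m\<close> = 0, 1, 2, and these
  enter only through \<open>D 0 * D 2 * D 1 ^ 2\<close>: \<open>y3\<close> carries the simple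
  factors \<open>D 0\<close> and \<open>D 2\<close>, \<open>y4\<close> the square of
  \<open>D 1\<close>, and \<open>y0\<close>, \<open>y1\<close>, \<open>y2\<close> are polynomial.
  Multiplied out, the formula is a polynomial identity (\<open>alpha_decomposition_cleared\<close>),
  which is divided back in a field (\<open>alpha_decomposition_field\<close>) and then specialised
  to rational functions. The shape of \<open>d2\<close> reflects the factor \<open>n\<close> of
  \<open>gamma(n,1,r)\<close>: at \<open>n = 0\<close>, for generic \<open>r\<close>, \<alpha>,
  \<open>y0\<close> and \<open>y1\<close> vanish while \<open>y2 = y3 = 1\<close> and
  \<open>y4 = -1\<close>, which forces \<open>d2 + d3 - d4 = 0\<close>.

  Independence (\<open>y_relation_trivial\<close>): a linear relation, cleared of denominators, is a
  polynomial identity, so it may be evaluated anywhere, even at the poles. Suitable points remove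
  the coefficients one after another. Coefficients are indexed by list position, so that one
  argument gives both distinctness and independence.\<close>

lemma (in vector_space) distinct_independent_listI:
  assumes zero: "\<And>c i. (\<Sum>k<length vs. scale (c k) (vs ! k)) = 0 \<Longrightarrow> i < length vs \<Longrightarrow> c i = 0"
  shows "distinct vs \<and> independent (set vs)"
proof
  show dist: "distinct vs"
    unfolding distinct_conv_nth
  proof (intro allI impI notI)
    fix i j assume ij: "i < length vs" "j < length vs" "i \<noteq> j" "vs ! i = vs ! j"
    \<comment> \<open>A repeated vector would give the nontrivial relation
      \<open>vs ! i - vs ! j = 0\<close>.\<close>
    define c where "c k = (if k = i then 1 else 0) - (if k = j then 1 else 0 :: 'a)" for k
    have "(\<Sum>k<length vs. scale (c k) (vs ! k)) = vs ! i - vs ! j"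
      using ij by (simp add: c_def scale_left_diff_distrib sum_subtractf if_distrib[of "\<lambda>a. scale a _"]
          cong: if_cong)
    then have "c i = 0"
      using zero[of c i] ij by simp
    then show False
      using ij by (simp add: c_def)
  qed
  show "independent (set vs)"
  proof (rule independent_if_scalars_zero)
    fix f x assume sum0: "(\<Sum>x\<in>set vs. scale (f x) x) = 0" and "x \<in> set vs"
    then obtain i where i: "i < length vs" "x = vs ! i"
      by (auto simp: in_set_conv_nth)
    have "(\<Sum>k<length vs. scale (f (vs ! k)) (vs ! k)) = (\<Sum>x\<in>set vs. scale (f x) x)"
      using dist by (simp add: sum.distinct_set_conv_list sum_list_sum_nth atLeast0LessThan)
    then show "f x = 0"
      using zero[of "\<lambda>k. f (vs ! k)" i] i sum0 by simp
  qed simp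
qed

text \<open>This is the decomposition multiplied by
  \<open>256 * r ^ 6 * D 0 * D 2 * D 1 ^ 2\<close>; the factor 1/2 in \<alpha> turns 256 into 128.
  Without division it is a pure polynomial identity.\<close>

lemma alpha_decomposition_cleared:
  fixes n r b0 b1 b2 s1 s2 :: "'a::idom"
  defines "X \<equiv> \<lambda>k. b0 + b1 * k + b2 * k * (k - 1)"
  defines "P \<equiv> \<lambda>m. (n - m + 1) * ((n * r - m * r + 1) * X (n - m) + (n - m) * s2 + s1)"
  defines "D \<equiv> \<lambda>m. (2 * n - m - 1) * r + 1"
  defines "q1 \<equiv> (b2 ^ 2 + 8 * b2 * (b0 + b1) - 4 * b1 ^ 2) * r ^ 2
     + 4 * b2 * (2 * s2 + b1 - 2 * b2) * r - 2 * b2 ^ 2"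
  defines "q2 \<equiv> (4 * b0 + 2 * b1 - b2) * r ^ 3 + (8 * s1 + 4 * s2 + 4 * b0 - b2) * r ^ 2
     + (b2 - 4 * s2 - 2 * b1) * r + b2"
  defines "q3 \<equiv> (2 * b1 - 4 * b0 - 3 * b2) * r ^ 3 + (8 * s1 - 4 * s2 + 4 * b0 - b2) * r ^ 2
     + (3 * b2 - 4 * s2 - 2 * b1) * r + b2"
  defines "q4 \<equiv> (8 * s1 + 4 * b0) * r ^ 2 + (2 * b2 - 4 * s2 - 2 * b1) * r + b2"
  shows "128 * r ^ 6 * (P 1 * (P 0 * D 1 * D 2 - 2 * P 1 * D 0 * D 2 + P 2 * D 0 * D 1
      - 2 * (X n - X (n - 1)) * D 0 * D 1 * D 2))
    = (b2 ^ 2 * ((4 * r ^ 2 * n) ^ 2 * (n * r - 2 * r + 1) ^ 2)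
       + q1 * (4 * r ^ 3 * n * (n * r - 2 * r + 1)) + (q4 ^ 2 - q2 * q3)) * D 0 * D 2 * D 1 ^ 2
      + q2 * q3 * ((r - 1) * (3 * r - 1)) * D 1 ^ 2 - q4 ^ 2 * (2 * r - 1) ^ 2 * D 0 * D 2"
  unfolding assms by algebra

text \<open>Serves both halves: it puts the \<open>y\<close> side of the decomposition over a common
  denominator, and it turns a linear relation among the \<open>y\<close> functions into a polynomial
  one. Here \<open>a\<close>, \<open>d\<close> are the denominators of \<open>y3\<close>, and
  \<open>b\<close> that of \<open>y4\<close> before squaring.\<close>

lemma clear_denominators:
  fixes a b d :: "'a::field"
  assumes "a \<noteq> 0" "b \<noteq> 0" "d \<noteq> 0"
  shows "(x + u * (e / (a * d)) + v * (- f / b ^ 2)) * (a * d * b ^ 2)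
    = x * a * d * b ^ 2 + u * e * b ^ 2 - v * f * a * d"
  using assms by (simp add: field_simps)

lemma alpha_decomposition_field:
  fixes n r b0 b1 b2 s1 s2 :: "'a::field"
  defines "X \<equiv> \<lambda>k. b0 + b1 * k + b2 * k * (k - 1)"
  defines "D \<equiv> \<lambda>m. (2 * n - m - 1) * r + 1"
  defines "g \<equiv> \<lambda>m. (n - m + 1) * ((n * r - m * r + 1) * X (n - m) + (n - m) * s2 + s1) / D m"
  defines "q1 \<equiv> (b2 ^ 2 + 8 * b2 * (b0 + b1) - 4 * b1 ^ 2) * r ^ 2
     + 4 * b2 * (2 * s2 + b1 - 2 * b2) * r - 2 * b2 ^ 2"
  defines "q2 \<equiv> (4 * b0 + 2 * b1 - b2) * r ^ 3 + (8 * s1 + 4 * s2 + 4 * b0 - b2) * r ^ 2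
     + (b2 - 4 * s2 - 2 * b1) * r + b2"
  defines "q3 \<equiv> (2 * b1 - 4 * b0 - 3 * b2) * r ^ 3 + (8 * s1 - 4 * s2 + 4 * b0 - b2) * r ^ 2
     + (3 * b2 - 4 * s2 - 2 * b1) * r + b2"
  defines "q4 \<equiv> (8 * s1 + 4 * b0) * r ^ 2 + (2 * b2 - 4 * s2 - 2 * b1) * r + b2"
  assumes two: "(2::'a) \<noteq> 0" and r: "r \<noteq> 0" and nz: "D 0 \<noteq> 0" "D 1 \<noteq> 0" "D 2 \<noteq> 0"
  shows "g 1 * (1 / 2 * (g 0 - 2 * g 1 + g 2) - (X n - X (n - 1)))
    = 1 / (256 * r ^ 6) *
      (b2 ^ 2 * ((4 * r ^ 2 * n) ^ 2 * (n * r - 2 * r + 1) ^ 2)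
       + q1 * (4 * r ^ 3 * n * (n * r - 2 * r + 1)) + (q4 ^ 2 - q2 * q3)
       + q2 * q3 * ((r - 1) * (3 * r - 1) / ((2 * n * r - r + 1) * (2 * n * r - 3 * r + 1)))
       + q4 ^ 2 * (- ((2 * r - 1) ^ 2) / (2 * n * r - 2 * r + 1) ^ 2))"
    (is "?L = 1 / (256 * r ^ 6) * (?A + q2 * q3 * (?B / _) + q4 ^ 2 * (- ?C / _))")
proof -
  define P where "P = (\<lambda>m. (n - m + 1) * ((n * r - m * r + 1) * X (n - m) + (n - m) * s2 + s1))"
  define Q where "Q = P 0 * D 1 * D 2 - 2 * P 1 * D 0 * D 2 + P 2 * D 0 * D 1
      - 2 * (X n - X (n - 1)) * D 0 * D 1 * D 2"
  define S where "S = ?A * D 0 * D 2 * D 1 ^ 2 + q2 * q3 * ?B * D 1 ^ 2 - q4 ^ 2 * ?C * D 0 * D 2"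
  have cleared: "128 * r ^ 6 * (P 1 * Q) = S"
    unfolding Q_def S_def P_def D_def X_def q1_def q2_def q3_def q4_def
    by (rule alpha_decomposition_cleared)
  \<comment> \<open>In a general field 256 could be zero; excluding characteristic 2
    suffices.\<close>
  have "(256::'a) = 2 ^ 8"
    by simp
  then have c256: "(256::'a) \<noteq> 0"
    using two by (metis power_not_zero)
  have gP: "g m = P m / D m" for m
    by (simp add: g_def P_def)
  have D: "2 * n * r - r + 1 = D 0" "2 * n * r - 3 * r + 1 = D 2" "2 * n * r - 2 * r + 1 = D 1"
    by (simp_all add: D_def algebra_simps)
  have "?L = P 1 * Q / (2 * D 0 * D 2 * D 1 ^ 2)"
    unfolding gP Q_def using two nz by (simp add: field_simps power2_eq_square)
  also have "\<dots> = S / (256 * r ^ 6 * (D 0 * D 2 * D 1 ^ 2))"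
    unfolding cleared[symmetric] using two nz r c256 by (simp add: frac_eq_eq)
  also have "S = D 0 * D 2 * D 1 ^ 2 * (?A + q2 * q3 * (?B / (D 0 * D 2)) + q4 ^ 2 * (- ?C / D 1 ^ 2))"
    unfolding S_def by (subst mult.commute) (rule clear_denominators[OF nz, symmetric])
  also have "\<dots> / (256 * r ^ 6 * (D 0 * D 2 * D 1 ^ 2))
    = 1 / (256 * r ^ 6) * (?A + q2 * q3 * (?B / (D 0 * D 2)) + q4 ^ 2 * (- ?C / D 1 ^ 2))"
    using nz r c256 by simp
  finally show ?thesis
    unfolding D .
qed

lemma to_fract_of_nat: "to_fract (of_nat k) = of_nat k"
  by (induction k) simp_all

lemma to_fract_numeral: "to_fract (numeral k) = numeral k"
  using to_fract_of_nat[of "numeral k"] by simp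

lemma to_fract_power: "to_fract (x ^ k) = to_fract x ^ k"
  by (induction k) simp_all

lemma Const_hom:
  "Const (a + b) = Const a + Const b" "Const (a - b) = Const a - Const b"
  "Const (a * b) = Const a * Const b" "Const (- a) = - Const a"
  "Const (a ^ k) = Const a ^ k" "Const (numeral m) = numeral m" "Const 1 = 1" "Const 0 = 0"
proof -
  show mult: "Const (a * b) = Const a * Const b" for a b
    by (simp add: Const_def flip: to_fract_mult)
  show one: "Const 1 = 1"
    by (simp add: Const_def flip: one_pCons)
  show "Const (a ^ k) = Const a ^ k"
    by (induction k) (simp_all add: mult one)
  show "Const (numeral m) = numeral m"
    by (simp add: Const_def flip: numeral_poly to_fract_numeral)
qed (simp_all add: Const_def flip: to_fract_add to_fract_diff to_fract_uminus)

lemma Const_eq_0_iff: "Const a = 0 \<longleftrightarrow> a = 0"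
  by (simp add: Const_def)

lemma Const_inverse: "Const (1 / a) = 1 / Const a"
proof (cases "a = 0")
  case False
  then have "Const (1 / a) * Const a = 1"
    by (simp add: Const_hom flip: Const_hom(3))
  then show ?thesis
    using False by (simp add: field_simps Const_eq_0_iff)
qed (simp add: Const_hom)

lemma denominator_nonzero:
  assumes "r \<noteq> 0"
  shows "(2 * Var - Const m - 1) * Const r + 1 \<noteq> 0"
proof -
  have "(2 * Var - Const m - 1) * Const r + 1 = to_fract ((2 * [:0, 1:] - [:m:] - 1) * [:r:] + 1)"
    by (simp only: Var_def Const_def to_fract_add to_fract_diff to_fract_mult to_fract_1 to_fract_numeral)
  \<comment> \<open>At \<open>(m + 1) / 2\<close> the factor multiplying \<open>r\<close> vanishes,
    so the polynomial takes the value 1 there and cannot be zero.\<close>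
  moreover have "poly ((2 * [:0, 1:] - [:m:] - 1) * [:r:] + 1) ((m + 1) / 2) = 1"
    by (simp add: algebra_simps)
  ultimately show ?thesis
    by (metis poly_0 to_fract_eq_0_iff zero_neq_one)
qed

lemma alpha_rf_decomposition:
  fixes r b0 b1 b2 s1 s2 :: complex
  assumes "r \<noteq> 0"
  shows "alpha_rf b0 b1 b2 s1 s2 Var r =
      scale_ratfun (1 / (256 * r ^ 6))
       (scale_ratfun (d0 b0 b1 b2 s1 s2 r) (y0 Var r)
      + scale_ratfun (d1 b0 b1 b2 s1 s2 r) (y1 Var r)
      + scale_ratfun (d2 b0 b1 b2 s1 s2 r) (y2 Var r)
      + scale_ratfun (d3 b0 b1 b2 s1 s2 r) (y3 Var r)
      + scale_ratfun (d4 b0 b1 b2 s1 s2 r) (y4 Var r))"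
proof -
  have two: "(2::ratfun) \<noteq> 0"
    using Const_eq_0_iff[of 2] by (simp add: Const_hom)
  note D = denominator_nonzero[OF assms, of 0] denominator_nonzero[OF assms, of 1]
    denominator_nonzero[OF assms, of 2]
  show ?thesis
    \<comment> \<open>Once \<open>Const\<close> is pushed down to the parameters, the goal is an
      instance of the field identity at \<open>n = Var\<close>.\<close>
    unfolding alpha_rf_def gamma_rf_def xk_def scale_ratfun_def d0_def d1_def d2_def d3_def d4_def
      p1_def p2_def p3_def p4_def y0_def y1_def y2_def y3_def y4_def Const_inverse Const_hom mult_1_right
    using D by (intro alpha_decomposition_field two) (simp_all add: Const_eq_0_iff assms Const_hom)
qed

text \<open>
  After clearing denominators the relation is a polynomial identity in \<open>z\<close>. The roots of the three
  denominators are distinct, so evaluating there isolates \<open>c 3\<close> and \<open>c 4\<close>; what remains is a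
  quadratic polynomial in \<open>w = z (z r - 2 r + 1)\<close>, which takes the values
  \<open>0\<close>, \<open>1 - r\<close> and \<open>2\<close> at \<open>z = 0, 1, 2\<close> (distinct since \<open>r \<noteq> - 1\<close>).
\<close>
lemma y_relation_trivial:
  fixes r :: complex and c :: "nat \<Rightarrow> complex"
  assumes r: "r \<notin> {0, 1, 1 / 2, 1 / 3, - 1, - 1 / 2, - 1 / 3}"
    and rel: "Const (c 0) * y0 Var r + Const (c 1) * y1 Var r + Const (c 2) * y2 Var r
      + Const (c 3) * y3 Var r + Const (c 4) * y4 Var r = 0"
  shows "c 0 = 0 \<and> c 1 = 0 \<and> c 2 = 0 \<and> c 3 = 0 \<and> c 4 = 0"
proof -
  have r0: "r \<noteq> 0" "r - 1 \<noteq> 0" "2 * r - 1 \<noteq> 0" "3 * r - 1 \<noteq> 0"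
    using r by (auto simp: field_simps add_eq_0_iff)
  define A where "A z = 2 * z * r - r + 1" for z
  define B where "B z = 2 * z * r - 2 * r + 1" for z
  define C where "C z = 2 * z * r - 3 * r + 1" for z
  define w where "w z = z * (z * r - 2 * r + 1)" for z
  \<comment> \<open>Since \<open>y0 = 16 * r ^ 4 * w ^ 2\<close> and
    \<open>y1 = 4 * r ^ 3 * w\<close>, this is the relation times \<open>A * C * B ^ 2\<close>. It
    holds for every \<open>z\<close>, zeros of \<open>A\<close>, \<open>B\<close>, \<open>C\<close>
    included, because it is proved for polynomials first.\<close>
  have eval: "(16 * r ^ 4 * c 0 * w z ^ 2 + 4 * r ^ 3 * c 1 * w z + c 2) * A z * C z * B z ^ 2
      + c 3 * ((r - 1) * (3 * r - 1)) * B z ^ 2 - c 4 * (2 * r - 1) ^ 2 * A z * C z = 0" for z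
  proof -
    let ?N = "[:0, 1:] :: complex poly" and ?R = "[:r:]"
    let ?A = "2 * ?N * ?R - ?R + 1" and ?B = "2 * ?N * ?R - 2 * ?R + 1" and ?C = "2 * ?N * ?R - 3 * ?R + 1"
    have D: "2 * Var * Const r - Const r + 1 \<noteq> 0" "2 * Var * Const r - 2 * Const r + 1 \<noteq> 0"
      "2 * Var * Const r - 3 * Const r + 1 \<noteq> 0"
      using denominator_nonzero[OF r0(1), of 0] denominator_nonzero[OF r0(1), of 1]
        denominator_nonzero[OF r0(1), of 2]
      by (simp_all add: Const_hom algebra_simps)
    \<comment> \<open>The cleared relation before embedding into fractions; injectivity of
      \<open>to_fract\<close> gives \<open>p = 0\<close>.\<close>
    define p where "p = ([:c 0:] * ((4 * ?R ^ 2 * ?N) ^ 2 * (?N * ?R - 2 * ?R + 1) ^ 2)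
        + [:c 1:] * (4 * ?R ^ 3 * ?N * (?N * ?R - 2 * ?R + 1)) + [:c 2:]) * ?A * ?C * ?B ^ 2
      + [:c 3:] * ((?R - 1) * (3 * ?R - 1)) * ?B ^ 2 - [:c 4:] * (2 * ?R - 1) ^ 2 * ?A * ?C"
    have "to_fract p = 0"
      using arg_cong[OF rel, of "\<lambda>x. x * ((2 * Var * Const r - Const r + 1)
          * (2 * Var * Const r - 3 * Const r + 1) * (2 * Var * Const r - 2 * Const r + 1) ^ 2)"]
      unfolding y0_def y1_def y2_def y3_def y4_def clear_denominators[OF D] mult_zero_left mult_1_right
      by (simp only: p_def Var_def Const_def to_fract_add to_fract_diff to_fract_mult to_fract_1
          to_fract_numeral to_fract_power)
    then have "poly p z = 0"
      by simp
    then show ?thesis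
      by (simp add: p_def A_def B_def C_def w_def power_mult_distrib mult_ac)
  qed
  have c3: "c 3 = 0"
  proof -
    \<comment> \<open>The root of \<open>A\<close>: only the \<open>c 3\<close> term
      survives.\<close>
    define z where "z = (r - 1) / (2 * r)"
    have "A z = 0" "B z = - r"
      using r0 by (simp_all add: A_def B_def z_def field_simps)
    then show ?thesis
      using eval[of z] r0 by simp
  qed
  have c4: "c 4 = 0"
  proof -
    \<comment> \<open>The root of \<open>B\<close>: only the \<open>c 4\<close> term
      survives.\<close>
    define z where "z = (2 * r - 1) / (2 * r)"
    have "A z = r" "B z = 0" "C z = - r"
      using r0 by (simp_all add: A_def B_def C_def z_def field_simps)
    then show ?thesis
      using eval[of z] r0 c3 by simp
  qed
  \<comment> \<open>These are the factors that \<open>A\<close>, \<open>B\<close>, \<open>C\<close>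
    and \<open>w\<close> produce at \<open>z\<close> = 0, 1, 2.\<close>
  have nz: "1 - r \<noteq> 0" "1 - 2 * r \<noteq> 0" "1 - 3 * r \<noteq> 0" "1 + r \<noteq> 0" "1 + 2 * r \<noteq> 0" "1 + 3 * r \<noteq> 0"
    using r by (auto simp: field_simps add_eq_0_iff)
  have c2: "c 2 = 0"
  proof -
    have "A 0 = 1 - r" "B 0 = 1 - 2 * r" "C 0 = 1 - 3 * r" "w 0 = 0"
      by (simp_all add: A_def B_def C_def w_def)
    then show ?thesis
      using eval[of 0] nz c3 c4 by simp
  qed
  \<comment> \<open>With \<open>c 2\<close>, \<open>c 3\<close>, \<open>c 4\<close> gone,
    \<open>w z\<close> divides out and leaves an expression linear in \<open>w z\<close>; two
    distinct values of \<open>w\<close> then determine it.\<close>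
  have lin: "4 * r * c 0 * w z + c 1 = 0" if "w z * (A z * C z * B z ^ 2) \<noteq> 0" for z
  proof -
    have "4 * r ^ 3 * (w z * (A z * C z * B z ^ 2)) * (4 * r * c 0 * w z + c 1) = 0"
      using eval[of z] c2 c3 c4 by algebra
    then show ?thesis
      using that r0 by simp
  qed
  have "A 1 = 1 + r" "B 1 = 1" "C 1 = 1 - r" "w 1 = 1 - r"
    by (simp_all add: A_def B_def C_def w_def)
  then have w1: "4 * r * c 0 * (1 - r) + c 1 = 0"
    using lin[of 1] nz by simp
  have "A 2 = 1 + 3 * r" "B 2 = 1 + 2 * r" "C 2 = 1 + r" "w 2 = 2"
    by (simp_all add: A_def B_def C_def w_def)
  then have w2: "4 * r * c 0 * 2 + c 1 = 0"
    using lin[of 2] nz by simp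
  have "4 * r * (1 + r) * c 0 = 0"
    using w1 w2 by algebra
  then have "c 0 = 0"
    using r0 nz by simp
  with w1 c2 c3 c4 show ?thesis
    by simp
qed

theorem mainTheorem3:
  fixes r b0 b1 b2 s1 s2 :: complex
  assumes "r \<noteq> 0"
    and "\<forall>m::nat. m > 0 \<longrightarrow> r \<noteq> - 1 / of_nat m"
  shows "alpha_rf b0 b1 b2 s1 s2 Var r =
      scale_ratfun (1 / (256 * r ^ 6))
       (scale_ratfun (d0 b0 b1 b2 s1 s2 r) (y0 Var r)
      + scale_ratfun (d1 b0 b1 b2 s1 s2 r) (y1 Var r)
      + scale_ratfun (d2 b0 b1 b2 s1 s2 r) (y2 Var r)
      + scale_ratfun (d3 b0 b1 b2 s1 s2 r) (y3 Var r)
      + scale_ratfun (d4 b0 b1 b2 s1 s2 r) (y4 Var r))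
    \<and> (r \<notin> {0, 1, 1 / 2, 1 / 3} \<longrightarrow>
         distinct [y0 Var r, y1 Var r, y2 Var r, y3 Var r, y4 Var r]
       \<and> ratfun.independent {y0 Var r, y1 Var r, y2 Var r, y3 Var r, y4 Var r})"
proof (intro conjI[OF alpha_rf_decomposition[OF assms(1)]] impI)
  assume r: "r \<notin> {0, 1, 1 / 2, 1 / 3}"
  let ?vs = "[y0 Var r, y1 Var r, y2 Var r, y3 Var r, y4 Var r]"
  \<comment> \<open>The cases \<open>m\<close> = 1, 2, 3 of the hypothesis keep the evaluations at 1
    and 2 nondegenerate.\<close>
  have r': "r \<notin> {0, 1, 1 / 2, 1 / 3, - 1, - 1 / 2, - 1 / 3}"
    using r assms(2)[rule_format, of 1] assms(2)[rule_format, of 2] assms(2)[rule_format, of 3]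
    by simp
  have "distinct ?vs \<and> ratfun.independent (set ?vs)"
  proof (rule ratfun.distinct_independent_listI)
    fix c :: "nat \<Rightarrow> complex" and i
    assume sum0: "(\<Sum>k<length ?vs. scale_ratfun (c k) (?vs ! k)) = 0" and i: "i < length ?vs"
    have "c 0 = 0 \<and> c 1 = 0 \<and> c 2 = 0 \<and> c 3 = 0 \<and> c 4 = 0"
      using r' sum0 by (intro y_relation_trivial) (simp_all add: scale_ratfun_def eval_nat_numeral)
    moreover have "i \<in> {0, 1, 2, 3, 4}"
      using i by auto
    ultimately show "c i = 0"
      by auto
  qed
  then show "distinct ?vs \<and> ratfun.independent {y0 Var r, y1 Var r, y2 Var r, y3 Var r, y4 Var r}"
    by simp
qed

end
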